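(* Let $n\ge 3$, let $\Gamma$ be a tree on the $n+1$ vertices $v_1,\dots,v_{n+1}$, labelled so that $v_{n+1}$ is a pendant vertex of $\Gamma$, and let $v_r$ be the unique vertex of $\Gamma$ adjacent to $v_{n+1}$. Let $A=(a_{ij})\in\mathbf{M}_{n+1}(\mathbb{R})$ be a singular matrix possessing the $\Gamma$-treeangle property, such that for every edge $\{v_i,v_j\}\in E(\Gamma)$ at least one of $a_{ij},a_{ji}$ is nonzero. Assume that $a_{ii}\neq 0$ for all interior vertices $v_i$ of $\Gamma$, and that the leading principal submatrix of $A$ of order $n$ (obtained by deleting the $(n+1)$-th row and column of $A$) is invertible. Then $A^\dagger$ is $\Gamma$-treediagonal if and only if $A$ or its transpose $A^T$ is of the form $$\begin{pmatrix} B & 0\\ \zeta(\mathbf{e}^r)^T B & 0\end{pmatrix}$$ for some real $\zeta\neq 0$, with the $r$-th column of $B$ being a nonzero multiple of $\mathbf{e}^r$, where $B\in\mathbf{M}_n(\mathbb{R})$ denotes the leading principal submatrix of order $n$ of the matrix in question ($A$ or $A^T$, respectively).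
   Context: All graphs are simple and undirected. $\mathbf{M}_m(\mathbb{R})$ is the set of real $m\times m$ matrices. $E(\Gamma)$ is the edge set of $\Gamma$. A vertex is pendant if it has degree $1$ and interior if it has degree greater than $1$. $\mathbf{e}^r$ denotes the $r$-th standard basis (column) vector of $\mathbb{R}^n$. For a tree $\Gamma$ on vertices $v_1,\dots,v_m$, a matrix $A=(a_{ij})\in\mathbf{M}_m(\mathbb{R})$ satisfies the $\Gamma$-treeangle property if $a_{ij}a_{kk}=a_{ik}a_{kj}$ for every triplet of vertices $v_i,v_j,v_k$ such that $v_k$ lies in the (unique) path joining $v_i$ and $v_j$ in $\Gamma$. A matrix $C=(c_{ij})\in\mathbf{M}_m(\mathbb{R})$ is $\Gamma$-treediagonal if $c_{ij}=c_{ji}=0$ whenever $i\ne j$ and $\{v_i,v_j\}\notin E(\Gamma)$, and at least one of $c_{ij},c_{ji}$ is nonzero whenever $\{v_i,v_j\}\in E(\Gamma)$. The Moore-Penrose inverse $A^\dagger$ of a square real matrix $A$ is the unique matrix $X$ with $AXA=A$, $XAX=X$, $(AX)^T=AX$, $(XA)^T=XA$. *)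

theory Defs
  imports
    "Graph_Theory.Graph_Theory"
    "Jordan_Normal_Form.Determinant"
begin

text \<open>
  Vertices and matrix indices are numbered from 0: the vertex \<open>i\<close> is $v_{i+1}$, and
  \<open>A $$ (i, j)\<close> is the entry $a_{i+1,j+1}$.

  A simple undirected graph is a \<open>pair_graph\<close>, i.e. a finite, loop-free, symmetric digraph without
  parallel arcs: the edge $\{u, v\}$ is the pair of arcs \<open>(u, v)\<close>, \<open>(v, u)\<close>.  The library's
  \<open>tree\<close> cannot be used for it, since \<open>pre_digraph.cycle\<close> admits the walk along an edge and back;
  the cycles of the undirected graph are those of length at least 3.
\<close>

definition tree_graph :: "'a pair_pre_digraph \<Rightarrow> bool" where
  "tree_graph G \<longleftrightarrow> pair_graph G \<and> Digraph_Component.connected (with_proj G) \<and>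
     \<not> (\<exists>p. pre_digraph.cycle (with_proj G) p \<and> 3 \<le> length p)"

text \<open>In a symmetric digraph the number of outgoing arcs is the degree of the undirected graph.\<close>

definition pendant :: "'a pair_pre_digraph \<Rightarrow> 'a \<Rightarrow> bool" where
  "pendant G v \<longleftrightarrow> v \<in> pverts G \<and> out_degree (with_proj G) v = 1"

definition interior_vertex :: "'a pair_pre_digraph \<Rightarrow> 'a \<Rightarrow> bool" where
  "interior_vertex G v \<longleftrightarrow> v \<in> pverts G \<and> out_degree (with_proj G) v > 1"

definition on_path :: "'a pair_pre_digraph \<Rightarrow> 'a \<Rightarrow> 'a \<Rightarrow> 'a \<Rightarrow> bool" where
  "on_path G u v w \<longleftrightarrow>
     (\<exists>p. pre_digraph.apath (with_proj G) u p v \<and> w \<in> set (pre_digraph.awalk_verts (with_proj G) u p))"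

definition treeangle_property :: "nat pair_pre_digraph \<Rightarrow> real mat \<Rightarrow> bool" where
  "treeangle_property G A \<longleftrightarrow>
     (\<forall>i\<in>pverts G. \<forall>j\<in>pverts G. \<forall>k\<in>pverts G.
        on_path G i j k \<longrightarrow> A $$ (i, j) * A $$ (k, k) = A $$ (i, k) * A $$ (k, j))"

definition treediagonal :: "nat pair_pre_digraph \<Rightarrow> real mat \<Rightarrow> bool" where
  "treediagonal G C \<longleftrightarrow>
     (\<forall>i\<in>pverts G. \<forall>j\<in>pverts G.
        (i \<noteq> j \<and> (i, j) \<notin> parcs G \<longrightarrow> C $$ (i, j) = 0 \<and> C $$ (j, i) = 0) \<and>
        ((i, j) \<in> parcs G \<longrightarrow> C $$ (i, j) \<noteq> 0 \<or> C $$ (j, i) \<noteq> 0))"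

definition is_moore_penrose :: "real mat \<Rightarrow> real mat \<Rightarrow> bool" where
  "is_moore_penrose A X \<longleftrightarrow> X \<in> carrier_mat (dim_col A) (dim_row A) \<and>
     A * X * A = A \<and> X * A * X = X \<and>
     transpose_mat (A * X) = A * X \<and> transpose_mat (X * A) = X * A"

definition moore_penrose_inverse :: "real mat \<Rightarrow> real mat" where
  "moore_penrose_inverse A = (THE X. is_moore_penrose A X)"

lemma is_moore_penrose_unique:
  assumes X: "is_moore_penrose A X" and Y: "is_moore_penrose A Y"
  shows "X = Y"
proof -
  define m n where "m = dim_row A" and "n = dim_col A"
  have cA: "A \<in> carrier_mat m n" by (simp add: m_def n_def)
  have cX: "X \<in> carrier_mat n m" and cY: "Y \<in> carrier_mat n m"
    using X Y by (auto simp: is_moore_penrose_def m_def n_def)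
  have x: "A * X * A = A" "X * A * X = X" "transpose_mat (A * X) = A * X" "transpose_mat (X * A) = X * A"
    using X by (auto simp: is_moore_penrose_def)
  have y: "A * Y * A = A" "Y * A * Y = Y" "transpose_mat (A * Y) = A * Y" "transpose_mat (Y * A) = Y * A"
    using Y by (auto simp: is_moore_penrose_def)
  have cAX: "A * X \<in> carrier_mat m m" and cAY: "A * Y \<in> carrier_mat m m"
    and cXA: "X * A \<in> carrier_mat n n" and cYA: "Y * A \<in> carrier_mat n n"
    using cA cX cY by auto
  have "A * X = transpose_mat ((A * Y) * (A * X))"
    using x(3) y(1) assoc_mult_mat[OF cAY cA cX] by simp
  also have "\<dots> = (A * X) * (A * Y)"
    using transpose_mult[OF cAY cAX] x(3) y(3) by simp
  also have "\<dots> = A * Y"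
    using x(1) assoc_mult_mat[OF cAX cA cY] by simp
  finally have AX: "A * X = A * Y" .
  have "X * A = transpose_mat ((X * A) * (Y * A))"
    using x(4) y(1) assoc_mult_mat[OF cX cA cYA] assoc_mult_mat[OF cA cY cA] by simp
  also have "\<dots> = (Y * A) * (X * A)"
    using transpose_mult[OF cXA cYA] x(4) y(4) by simp
  also have "\<dots> = Y * A"
    using x(1) assoc_mult_mat[OF cY cA cXA] assoc_mult_mat[OF cA cX cA] by simp
  finally have XA: "X * A = Y * A" .
  have "X = Y * A * X" using x(2) XA by simp
  also have "\<dots> = Y * A * Y"
    using AX assoc_mult_mat[OF cY cA cX] assoc_mult_mat[OF cY cA cY] by simp
  finally show ?thesis using y(2) by simp
qed

lemma moore_penrose_inverse_eqI:
  "is_moore_penrose A X \<Longrightarrow> moore_penrose_inverse A = X"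
  unfolding moore_penrose_inverse_def by (blast intro: is_moore_penrose_unique)

text \<open>\<open>mat_of_row (unit_vec n r)\<close> is the row vector $(\mathbf{e}^r)^T$.\<close>

definition has_block_form :: "nat \<Rightarrow> nat \<Rightarrow> real mat \<Rightarrow> bool" where
  "has_block_form n r M \<longleftrightarrow>
     (let B = mat_delete M n n in
       (\<exists>\<zeta>. \<zeta> \<noteq> 0 \<and>
          M = four_block_mat
                B                                         (0\<^sub>m n 1)
                (\<zeta> \<cdot>\<^sub>m (mat_of_row (unit_vec n r) * B))   (0\<^sub>m 1 1)) \<and>
       (\<exists>c. c \<noteq> 0 \<and> col B r = c \<cdot>\<^sub>v unit_vec n r))"

end

theory Submission
  imports Defs
begin

text \<open>
  Write \<open>B\<close> for the leading block of \<open>A\<close> and \<open>C\<close> for its inverse;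
  the scaling factors \<open>\<zeta>\<close> and \<open>\<eta>\<close> below are \<open>z\<close> and \<open>y\<close> in the lemmas.  Every
  path to the pendant vertex enters it through \<open>r\<close>, so the treeangle property makes the last column
  of \<open>A\<close> equal to \<open>\<eta>\<close> times column \<open>r\<close> and the last row equal to \<open>\<zeta>\<close> times row \<open>r\<close>; in the corner this
  is forced by singularity, since \<open>B\<close> is invertible (\<open>proportional_row_of_singular\<close>).  Thus \<open>A\<close> is \<open>B\<close>
  with index \<open>r\<close> doubled, up to scaling the copy: $A = P B Q$ with
  $P = (I; \zeta (e^r)^T)$ and $Q = (I, \eta e^r)$.  This is a full rank factorisation,
  and $P^T P$ and $Q Q^T$ are diagonal, so $A^\dagger$ is \<open>C\<close> with index \<open>r\<close> doubled, again up to
  scaling (\<open>moore_penrose_inflate\<close>).  The new row of $A^\dagger$ vanishes if \<open>\<eta> = 0\<close> and the new column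
  vanishes if \<open>\<zeta> = 0\<close>; apart from this, all scaling factors are nonzero.

  The matrix \<open>C\<close> itself has the zero pattern of the tree without the pendant vertex, by an explicit
  formula for the inverse of an invertible matrix with the treeangle property
  (\<open>tree_matrix.mult_inv_mat\<close>).  So $A^\dagger$ is treediagonal exactly when its new row and column fit
  the tree, which means three things: \<open>C\<close> has nonzero entry at \<open>(r, r)\<close>; if \<open>\<zeta> \<noteq> 0\<close> then column \<open>r\<close> of \<open>C\<close>
  is zero off the diagonal; if \<open>\<eta> \<noteq> 0\<close> then so is row \<open>r\<close>.  Both cannot happen together, as \<open>r\<close> has
  another neighbour \<open>s\<close>, and \<open>C\<close> has a nonzero entry at \<open>(r, s)\<close> or at \<open>(s, r)\<close>.  Hence exactly one of
  \<open>\<zeta>\<close>, \<open>\<eta>\<close> is nonzero; the case \<open>\<eta> = 0\<close> is the block form of \<open>A\<close> and the case \<open>\<zeta> = 0\<close> that of its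
  transpose, because column \<open>r\<close> of \<open>C\<close> is a nonzero multiple of a unit vector iff that of \<open>B\<close> is.
\<close>

section \<open>Paths in trees\<close>

lemma on_path_sym:
  assumes "tree_graph G" and "on_path G i j k"
  shows "on_path G j i k"
proof -
  interpret pair_graph G using assms(1) by (simp add: tree_graph_def)
  from assms(2) obtain p where p: "apath i p j" "k \<in> set (awalk_verts i p)"
    by (auto simp: on_path_def awalk_verts_with_proj_eq)
  then have "apath j (rev_path p) i" "k \<in> set (awalk_verts j (rev_path p))"
    by (auto simp: apath_def awalk_verts_rev_path)
  then show ?thesis unfolding on_path_def awalk_verts_with_proj_eq by blast
qed

lemma interior_vertexI:
  assumes "tree_graph G" and "(m, x) \<in> parcs G" "(m, y) \<in> parcs G" "x \<noteq> y"
  shows "interior_vertex G m"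
proof -
  interpret pair_graph G using assms(1) by (simp add: tree_graph_def)
  have sub: "{(m, x), (m, y)} \<subseteq> out_arcs (with_proj G) m"
    using assms by (auto simp: out_arcs_def)
  have "finite (out_arcs (with_proj G) m)"
    by (rule finite_subset[OF _ pair_finite_arcs]) (auto simp: out_arcs_def)
  from card_mono[OF this sub] show ?thesis
    using assms in_arcsD1 by (auto simp: interior_vertex_def out_degree_def)
qed

text \<open>
  The vertex \<open>m\<close> is the last one before \<open>j\<close> on a path from \<open>i\<close> to \<open>j\<close>.  Any other neighbour \<open>k\<close> of \<open>j\<close>
  lies off that path, for otherwise the edge \<open>{j, k}\<close> would close the part of the path from \<open>k\<close> on to
  a cycle; so the path extends to \<open>k\<close>, through \<open>j\<close>.  The formula for the inverse below rests on
  this local form of the tree structure.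
\<close>

lemma tree_gate:
  assumes tree: "tree_graph G" and ij: "i \<in> pverts G" "j \<in> pverts G" "i \<noteq> j"
  obtains m where "(m, j) \<in> parcs G" "on_path G i j m" "m = i \<or> interior_vertex G m"
    "\<And>k. (j, k) \<in> parcs G \<Longrightarrow> k \<noteq> m \<Longrightarrow> on_path G i k j"
proof -
  interpret pair_graph G using tree by (simp add: tree_graph_def)
  have "i \<rightarrow>\<^sup>*\<^bsub>mk_symmetric (with_proj G)\<^esub> j"
    using tree ij unfolding tree_graph_def connected_def strongly_connected_def by auto
  then have "i \<rightarrow>\<^sup>*\<^bsub>with_proj G\<^esub> j"
    by (simp only: reachable_mk_symmetric_eq[OF pair_sym_arcs])
  then obtain p where p: "apath i p j" by (auto simp: reachable_apath)
  with ij have "p \<noteq> []" by (auto simp: apath_Nil_iff)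
  then obtain q m m' where "p = q @ [(m, m')]" by (cases p rule: rev_cases) auto
  moreover from this p have "m' = j" by (auto simp: apath_append_iff apath_simps)
  ultimately have q: "p = q @ [(m, j)]" by simp
  have parts: "apath i q m" "(m, j) \<in> parcs G" "j \<notin> set (pawalk_verts i q)"
    using p unfolding q by (auto simp: apath_append_iff apath_simps)
  have verts_p: "pawalk_verts i p = pawalk_verts i q @ [j]"
    using p parts unfolding q apath_def by (subst awalk_verts_append[where v = j]) auto
  have m_on: "m \<in> set (pawalk_verts i q)"
    using parts(1) unfolding apath_def by auto
  have 1: "on_path G i j m"
    using p m_on verts_p by (auto simp: on_path_def awalk_verts_with_proj_eq)
  have 2: "m = i \<or> interior_vertex G m"
  proof (cases q rule: rev_cases)
    case Nil
    then show ?thesis using parts(1) by (auto simp: apath_Nil_iff)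
  next
    case (snoc q' e')
    then have "snd e' = m" "e' \<in> parcs G" "apath i q' (fst e')"
      using parts(1) by (auto simp: apath_append_iff apath_simps)
    moreover have "fst e' \<in> set (pawalk_verts i q)"
      using set_awalk_verts[OF awalkI_apath[OF parts(1)]] snoc by auto
    ultimately have "(m, fst e') \<in> parcs G" "fst e' \<noteq> j"
      using parts(3) by (auto intro: arcs_symmetric)
    then show ?thesis using interior_vertexI[OF tree _ parts(2)] by blast
  qed
  have 3: "on_path G i k j" if jk: "(j, k) \<in> parcs G" and "k \<noteq> m" for k
  proof -
    have "k \<noteq> j" using jk no_loops' by auto
    \<comment> \<open>If \<open>k\<close> were on the path, its tail from \<open>k\<close> would have at least two arcs, since it ends with
      \<open>(m, j)\<close> and \<open>k \<noteq> m\<close>.  With \<open>(j, k)\<close> in front this is a cycle of length at least 3.\<close>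
    have "k \<notin> set (pawalk_verts i p)"
    proof
      assume "k \<in> set (pawalk_verts i p)"
      then obtain p1 p2 where dec: "p = p1 @ p2" "awalk i p1 k" "awalk k p2 j"
        using awalk_decomp[of i p j k] p by (auto simp: apath_def)
      then have p2: "apath k p2 j" using p
        by (auto simp: apath_append_iff)
      have "p2 \<noteq> []" using p2 \<open>k \<noteq> j\<close> by (auto simp: apath_Nil_iff)
      then obtain q2 where q2: "p2 = q2 @ [(m, j)]"
        using dec(1) unfolding q by (metis append_butlast_last_id last_appendR last_snoc)
      have "q2 \<noteq> []"
      proof
        assume "q2 = []"
        then have "k = m" using p2 unfolding q2 by (auto simp: apath_simps)
        with that show False by simp
      qed
      have "awalk j ((j, k) # p2) j"
        using p2 jk by (auto simp: apath_def awalk_Cons_iff)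
      moreover have "distinct (tl (pawalk_verts j ((j, k) # p2)))"
        using p2 by (auto simp: apath_def)
      ultimately have "cycle ((j, k) # p2)" unfolding cycle_def by auto
      moreover have "3 \<le> length ((j, k) # p2)" using q2 \<open>q2 \<noteq> []\<close> by (cases q2) auto
      ultimately show False using tree unfolding tree_graph_def by blast
    qed
    have walk: "awalk i (p @ [(j, k)]) k"
      using p jk in_arcsD2[OF jk] by (auto simp: apath_def awalk_simps)
    have "pawalk_verts i (p @ [(j, k)]) = pawalk_verts i p @ [k]"
      using awalk_verts_append[OF walk] by simp
    with walk p \<open>k \<notin> set (pawalk_verts i p)\<close>
    have "apath i (p @ [(j, k)]) k" "j \<in> set (pawalk_verts i (p @ [(j, k)]))"
      by (auto simp: apath_def)
    then show ?thesis unfolding on_path_def awalk_verts_with_proj_eq by blast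
  qed
  from that[OF parts(2) 1 2 3] show thesis by blast
qed

lemma pendant_unique_neighbour:
  assumes "tree_graph G" "pendant G v" "(v, x) \<in> parcs G" "(v, y) \<in> parcs G"
  shows "x = y"
  using interior_vertexI[OF assms(1,3,4)] assms(2)
  by (auto simp: pendant_def interior_vertex_def)


section \<open>The inverse of a matrix with the treeangle property\<close>

definition edge_minor :: "real mat \<Rightarrow> nat \<Rightarrow> nat \<Rightarrow> real" where
  "edge_minor B i j = B $$ (i, i) * B $$ (j, j) - B $$ (i, j) * B $$ (j, i)"

lemma edge_minor_commute: "edge_minor B i j = edge_minor B j i"
  by (simp add: edge_minor_def)

lemma index_mult_sum:
  fixes M N :: "real mat"
  assumes "M \<in> carrier_mat a b" "N \<in> carrier_mat b c" "i < a" "j < c"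
  shows "(M * N) $$ (i, j) = (\<Sum>k<b. M $$ (i, k) * N $$ (k, j))"
  using assms by (auto simp: scalar_prod_def lessThan_atLeast0)

text \<open>
  The relation \<open>E\<close> is the adjacency of a tree, and \<open>g i j\<close> is the neighbour of \<open>j\<close> towards \<open>i\<close>.  Of the
  treeangle property only the two instances at an edge are recorded: one step before the end of a
  path (\<open>through_gate\<close>) and one step beyond it (\<open>through_vertex\<close>).  Stated in this way, the results apply
  to a subtree of a graph without constructing the subgraph.
\<close>

locale tree_matrix =
  fixes n :: nat and E :: "nat \<Rightarrow> nat \<Rightarrow> bool" and g :: "nat \<Rightarrow> nat \<Rightarrow> nat" and B :: "real mat"
  assumes n2: "2 \<le> n"
    and B: "B \<in> carrier_mat n n"
    and E_less: "E i j \<Longrightarrow> i < n \<and> j < n"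
    and E_irrefl: "\<not> E i i"
    and E_sym: "E i j \<Longrightarrow> E j i"
    and gate: "i < n \<Longrightarrow> j < n \<Longrightarrow> i \<noteq> j \<Longrightarrow> E (g i j) j"
    and through_gate: "i < n \<Longrightarrow> j < n \<Longrightarrow> i \<noteq> j \<Longrightarrow>
      B $$ (i, j) * B $$ (g i j, g i j) = B $$ (i, g i j) * B $$ (g i j, j)"
    and through_vertex: "i < n \<Longrightarrow> i \<noteq> j \<Longrightarrow> E j k \<Longrightarrow> k \<noteq> g i j \<Longrightarrow>
      B $$ (i, k) * B $$ (j, j) = B $$ (i, j) * B $$ (j, k)"
    and zero_diag_leaf: "E j k \<Longrightarrow> E j k' \<Longrightarrow> B $$ (j, j) = 0 \<Longrightarrow> k = k'"
    and edge_nonzero_diag: "E j k \<Longrightarrow> B $$ (j, j) \<noteq> 0 \<or> B $$ (k, k) \<noteq> 0"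
begin

text \<open>
  The second form solves the equation at \<open>(j, j)\<close> of the product with \<open>B\<close> being the identity, given
  the off-diagonal entries of \<open>inv_mat\<close>.  If the diagonal entry of \<open>B\<close> is zero, that equation does not
  involve the unknown; then \<open>j\<close> is a leaf, the sum in the first form has a single term, and its
  value comes from the equations at \<open>(i, j)\<close> for \<open>i \<noteq> j\<close>.
\<close>

definition inv_diag :: "nat \<Rightarrow> real" where
  "inv_diag j = (if B $$ (j, j) = 0 then \<Sum>k | E j k. B $$ (k, k) / edge_minor B j k
     else (1 + (\<Sum>k | E j k. B $$ (j, k) * B $$ (k, j) / edge_minor B j k)) / B $$ (j, j))"

definition inv_mat :: "real mat" where
  "inv_mat = mat n n (\<lambda>(i, j). if i = j then inv_diag j
     else if E i j then - B $$ (i, j) / edge_minor B i j else 0)"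

text \<open>
  If the minor of the edge \<open>{j, k}\<close> vanished, then columns \<open>j\<close> and \<open>k\<close> of \<open>B\<close> would be dependent: a row
  index on the side of \<open>j\<close> reaches \<open>k\<close> through \<open>j\<close>, which gives the relation between the two entries
  directly, and from the side of \<open>k\<close> it follows by the vanishing of the minor.
\<close>

lemma edge_minor_nonzero:
  assumes C: "C \<in> carrier_mat n n" "C * B = 1\<^sub>m n" and jk: "E j k"
  shows "edge_minor B j k \<noteq> 0"
proof -
  \<comment> \<open>The minor is symmetric in the edge, so the end with nonzero diagonal entry may be called \<open>j\<close>.\<close>
  have *: "edge_minor B j k \<noteq> 0" if jk: "E j k" and jj: "B $$ (j, j) \<noteq> 0" for j k
  proof
    assume "edge_minor B j k = 0"
    then have minor: "B $$ (j, j) * B $$ (k, k) = B $$ (j, k) * B $$ (k, j)"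
      by (simp add: edge_minor_def)
    have jk': "j < n" "k < n" "j \<noteq> k" using E_less[OF jk] E_irrefl jk by auto
    have col: "B $$ (i, k) * B $$ (j, j) = B $$ (i, j) * B $$ (j, k)" if i: "i < n" for i
    proof (cases "i = j \<or> g i j \<noteq> k")
      case True
      then show ?thesis using through_vertex[OF i _ jk] by (cases "i = j") auto
    next
      case False
      show ?thesis
      proof (cases "i = k")
        case True
        then show ?thesis using minor by (simp add: mult.commute)
      next
        case ik: False
        have gj: "B $$ (i, j) * B $$ (k, k) = B $$ (i, k) * B $$ (k, j)"
          using through_gate[of i j] i jk' False by auto
        show ?thesis
        proof (cases "B $$ (k, k) = 0")
          case True
          have "g i k = j"
            using zero_diag_leaf[OF E_sym[OF gate[OF i jk'(2) ik]] E_sym[OF jk] True] .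
          then show ?thesis using through_gate[OF i jk'(2) ik] by simp
        next
          case False
          have "(B $$ (i, k) * B $$ (j, j)) * B $$ (k, k) = (B $$ (i, j) * B $$ (j, k)) * B $$ (k, k)"
          proof -
            have "(B $$ (i, k) * B $$ (j, j)) * B $$ (k, k) = B $$ (i, k) * (B $$ (j, k) * B $$ (k, j))"
              by (simp add: minor)
            also have "\<dots> = (B $$ (i, k) * B $$ (k, j)) * B $$ (j, k)" by (simp add: mult_ac)
            finally show ?thesis by (simp add: mult_ac flip: gj)
          qed
          with False show ?thesis by simp
        qed
      qed
    qed
    have "(C * B) $$ (k, k) * B $$ (j, j) = (C * B) $$ (k, j) * B $$ (j, k)"
      using jk' col by (simp add: index_mult_sum[OF C(1) B] sum_distrib_right mult.assoc)
    then show False using jk' jj unfolding C(2) by simp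
  qed
  from edge_nonzero_diag[OF jk] show ?thesis
    using *[OF jk] *[OF E_sym[OF jk]] by (auto simp: edge_minor_commute)
qed

text \<open>
  In the entry \<open>(i, j)\<close> of the product, only \<open>j\<close> and its neighbours contribute.  If \<open>i \<noteq> j\<close>, the neighbours away
  from \<open>i\<close> cancel against their terms in the diagonal entry, by \<open>through_vertex\<close>; the remaining term
  is a multiple of the difference of the two sides of \<open>through_gate\<close>.
\<close>

lemma mult_inv_mat:
  assumes C: "C \<in> carrier_mat n n" "C * B = 1\<^sub>m n"
  shows "B * inv_mat = 1\<^sub>m n"
proof (rule eq_matI)
  show "dim_row (B * inv_mat) = dim_row (1\<^sub>m n)" "dim_col (B * inv_mat) = dim_col (1\<^sub>m n)"
    using B by (auto simp: inv_mat_def)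
  fix i j assume "i < dim_row (1\<^sub>m n :: real mat)" "j < dim_col (1\<^sub>m n :: real mat)"
  then have ij: "i < n" "j < n" by auto
  note minor = edge_minor_nonzero[OF C]
  have fin: "finite {k. E j k}" by (rule finite_subset[of _ "{..<n}"]) (use E_less in auto)
  have "(B * inv_mat) $$ (i, j) = (\<Sum>k<n. B $$ (i, k) * inv_mat $$ (k, j))"
    by (rule index_mult_sum[OF B _ ij]) (simp add: inv_mat_def)
  also have "\<dots> = B $$ (i, j) * inv_mat $$ (j, j) + (\<Sum>k\<in>{..<n} - {j}. B $$ (i, k) * inv_mat $$ (k, j))"
    using ij by (subst sum.remove[of _ j]) auto
  also have "(\<Sum>k\<in>{..<n} - {j}. B $$ (i, k) * inv_mat $$ (k, j)) =
      (\<Sum>k | E j k. - (B $$ (i, k) * B $$ (k, j) / edge_minor B j k))"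
  proof (intro sum.mono_neutral_cong_right ballI)
    show "{k. E j k} \<subseteq> {..<n} - {j}" using E_less E_irrefl by auto
    fix k assume k: "k \<in> {..<n} - {j} - {k. E j k}"
    then have "\<not> E k j" using E_sym by blast
    then show "B $$ (i, k) * inv_mat $$ (k, j) = 0" using k ij by (simp add: inv_mat_def)
  next
    fix k assume "k \<in> {k. E j k}"
    then have k: "E k j" using E_sym by blast
    then have "k \<noteq> j" "k < n" using E_irrefl E_less[OF k] by auto
    then show "B $$ (i, k) * inv_mat $$ (k, j) = - (B $$ (i, k) * B $$ (k, j) / edge_minor B j k)"
      using k ij by (simp add: inv_mat_def edge_minor_commute[of B j k])
  qed auto
  finally have entry: "(B * inv_mat) $$ (i, j) =
      B $$ (i, j) * inv_diag j - (\<Sum>k | E j k. B $$ (i, k) * B $$ (k, j) / edge_minor B j k)"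
    using ij by (simp add: inv_mat_def sum_negf)
  have "(B * inv_mat) $$ (i, j) = (if i = j then 1 else 0)"
  proof (cases "B $$ (j, j) = 0")
    case zero: True
    \<comment> \<open>Any vertex other than \<open>j\<close>: it shows that \<open>j\<close> has a neighbour at all.\<close>
    define l :: nat where "l = (if j = 0 then 1 else 0)"
    have l: "l < n" "l \<noteq> j" using n2 by (auto simp: l_def)
    have leaf: "{k. E j k} = {q}" if "E j q" for q using zero_diag_leaf[OF _ that zero] that by blast
    show ?thesis
    proof (cases "i = j")
      case True
      define q where "q = g l j"
      have q: "E j q" using E_sym[OF gate[OF l(1) ij(2) l(2)]] by (simp add: q_def)
      have "edge_minor B j q = - (B $$ (j, q) * B $$ (q, j))" by (simp add: edge_minor_def zero)
      then show ?thesis unfolding entry leaf[OF q] using True zero minor[OF q] by simp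
    next
      case False
      define q where "q = g i j"
      have q: "E j q" using E_sym[OF gate[OF ij False]] by (simp add: q_def)
      show ?thesis unfolding entry inv_diag_def leaf[OF q]
        using zero False through_gate[OF ij False] by (simp add: q_def)
    qed
  next
    case nz: False
    show ?thesis
    proof (cases "i = j")
      case True
      then show ?thesis unfolding entry inv_diag_def using nz by simp
    next
      case False
      define q where "q = g i j"
      have q: "E j q" using E_sym[OF gate[OF ij False]] by (simp add: q_def)
      have far: "B $$ (i, k) * B $$ (k, j) / edge_minor B j k =
          B $$ (i, j) / B $$ (j, j) * (B $$ (j, k) * B $$ (k, j) / edge_minor B j k)"
        if "E j k" "k \<noteq> q" for k
      proof -
        have "B $$ (i, k) = B $$ (i, j) / B $$ (j, j) * B $$ (j, k)"
          using through_vertex[OF ij(1) False that(1)] that(2) nz by (simp add: q_def eq_divide_eq)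
        then show ?thesis by (simp only: mult.assoc times_divide_eq_right)
      qed
      define S where "S = (\<Sum>k\<in>{k. E j k} - {q}. B $$ (j, k) * B $$ (k, j) / edge_minor B j k)"
      have "(\<Sum>k | E j k. B $$ (j, k) * B $$ (k, j) / edge_minor B j k)
          = B $$ (j, q) * B $$ (q, j) / edge_minor B j q + S"
        unfolding S_def by (rule sum.remove) (use fin q in auto)
      moreover have "(\<Sum>k | E j k. B $$ (i, k) * B $$ (k, j) / edge_minor B j k)
          = B $$ (i, q) * B $$ (q, j) / edge_minor B j q + B $$ (i, j) / B $$ (j, j) * S"
        unfolding S_def sum_distrib_left
        by (subst sum.remove[of _ q]) (use fin q far in \<open>auto intro!: sum.cong\<close>)
      ultimately have "(B * inv_mat) $$ (i, j) = B $$ (i, j) / B $$ (j, j)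
          * (1 + B $$ (j, q) * B $$ (q, j) / edge_minor B j q)
          - B $$ (i, q) * B $$ (q, j) / edge_minor B j q"
        unfolding entry inv_diag_def using nz by (simp add: algebra_simps add_divide_distrib)
      also have "1 + B $$ (j, q) * B $$ (q, j) / edge_minor B j q
          = B $$ (j, j) * B $$ (q, q) / edge_minor B j q"
      proof -
        have "1 = edge_minor B j q / edge_minor B j q" using minor[OF q] by simp
        then show ?thesis by (metis add_divide_distrib edge_minor_def diff_add_cancel)
      qed
      finally show ?thesis using through_gate[OF ij False] nz False by (simp add: q_def field_simps)
    qed
  qed
  then show "(B * inv_mat) $$ (i, j) = 1\<^sub>m n $$ (i, j)" using ij by simp
qed

lemma inverse_eq_inv_mat:
  assumes C: "C \<in> carrier_mat n n" "C * B = 1\<^sub>m n"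
  shows "C = inv_mat"
proof -
  have D: "inv_mat \<in> carrier_mat n n" by (simp add: inv_mat_def)
  have "C = C * (B * inv_mat)" using mult_inv_mat[OF C] C by simp
  also have "\<dots> = C * B * inv_mat" using assoc_mult_mat[OF C(1) B D] by simp
  finally show ?thesis using C D by simp
qed

lemma inverse_zero_off_edges:
  assumes C: "C \<in> carrier_mat n n" "C * B = 1\<^sub>m n" and "i < n" "j < n" "i \<noteq> j" "\<not> E i j"
  shows "C $$ (i, j) = 0"
  using assms by (simp add: inverse_eq_inv_mat[OF C] inv_mat_def)

lemma inverse_zero_on_edges_iff:
  assumes C: "C \<in> carrier_mat n n" "C * B = 1\<^sub>m n" and ij: "E i j"
  shows "C $$ (i, j) = 0 \<longleftrightarrow> B $$ (i, j) = 0"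
  using assms E_less[OF ij] E_irrefl edge_minor_nonzero[OF C ij]
  by (auto simp: inverse_eq_inv_mat[OF C] inv_mat_def)

end

section \<open>The Moore-Penrose inverse of an inflated matrix\<close>

text \<open>
  Index \<open>i\<close> of the inflated matrix is a scaled copy of index \<open>f i\<close> of \<open>B\<close>.  In other words, this is
  $P B Q$, where \<open>P\<close> has the single entry \<open>u i\<close> in row \<open>i\<close>, at column \<open>f i\<close>, and \<open>Q\<close> has the single entry
  \<open>v j\<close> in column \<open>j\<close>, at row \<open>f j\<close>.
\<close>

definition inflate ::
  "nat \<Rightarrow> (nat \<Rightarrow> nat) \<Rightarrow> (nat \<Rightarrow> real) \<Rightarrow> (nat \<Rightarrow> real) \<Rightarrow> real mat \<Rightarrow> real mat" where
  "inflate m f u v B = mat m m (\<lambda>(i, j). u i * B $$ (f i, f j) * v j)"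

text \<open>
  The assumption \<open>unit\<close> says that the two inner factors, the \<open>Q\<close> of the first matrix and the \<open>P\<close> of the
  second, multiply to the identity.
\<close>

lemma inflate_mult:
  assumes B: "B \<in> carrier_mat n n" and C: "C \<in> carrier_mat n n"
    and f: "\<And>i. i < m \<Longrightarrow> f i < n"
    and unit: "\<And>a. a < n \<Longrightarrow> (\<Sum>k | k < m \<and> f k = a. v k * v' k) = 1"
  shows "inflate m f u v B * inflate m f v' w C = inflate m f u w (B * C)"
proof (rule eq_matI)
  fix i j assume "i < dim_row (inflate m f u w (B * C))" "j < dim_col (inflate m f u w (B * C))"
  then have ij: "i < m" "j < m" by (auto simp: inflate_def)
  define h where "h a = u i * B $$ (f i, a) * C $$ (a, f j) * w j" for a
  have "(inflate m f u v B * inflate m f v' w C) $$ (i, j)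
      = (\<Sum>k<m. inflate m f u v B $$ (i, k) * inflate m f v' w C $$ (k, j))"
    by (rule index_mult_sum[of _ m m _ m, OF _ _ ij]) (auto simp: inflate_def)
  also have "\<dots> = (\<Sum>k<m. h (f k) * (v k * v' k))"
    using ij by (intro sum.cong) (auto simp: inflate_def h_def)
  also have "\<dots> = (\<Sum>a<n. \<Sum>k | k \<in> {..<m} \<and> f k = a. h (f k) * (v k * v' k))"
    using f by (intro sum.group[symmetric]) auto
  also have "\<dots> = (\<Sum>a<n. h a * (\<Sum>k | k < m \<and> f k = a. v k * v' k))"
    by (simp add: sum_distrib_left)
  also have "\<dots> = (\<Sum>a<n. h a)" using unit by simp
  also have "\<dots> = u i * (B * C) $$ (f i, f j) * w j"
    by (simp add: index_mult_sum[OF B C f[OF ij(1)] f[OF ij(2)]] h_def sum_distrib_left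
        sum_distrib_right mult.assoc)
  finally show "(inflate m f u v B * inflate m f v' w C) $$ (i, j) = inflate m f u w (B * C) $$ (i, j)"
    using ij by (simp add: inflate_def)
qed (auto simp: inflate_def)

text \<open>These are the diagonal entries of $P^T P$.\<close>

definition class_weight :: "nat \<Rightarrow> (nat \<Rightarrow> nat) \<Rightarrow> (nat \<Rightarrow> real) \<Rightarrow> nat \<Rightarrow> real" where
  "class_weight m f u a = (\<Sum>k | k < m \<and> f k = a. u k * u k)"

text \<open>
  The entry at \<open>(k, f k)\<close> of $P (P^T P)^{-1}$, the transpose of the Moore-Penrose inverse of \<open>P\<close>.
\<close>

definition dual_weight :: "nat \<Rightarrow> (nat \<Rightarrow> nat) \<Rightarrow> (nat \<Rightarrow> real) \<Rightarrow> nat \<Rightarrow> real" where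
  "dual_weight m f u k = u k / class_weight m f u (f k)"

lemma dual_weight_unit:
  assumes "class_weight m f u a \<noteq> 0"
  shows "(\<Sum>k | k < m \<and> f k = a. u k * dual_weight m f u k) = 1"
proof -
  have "(\<Sum>k | k < m \<and> f k = a. u k * dual_weight m f u k)
      = (\<Sum>k | k < m \<and> f k = a. u k * u k / class_weight m f u a)"
    by (intro sum.cong) (auto simp: dual_weight_def)
  also have "\<dots> = class_weight m f u a / class_weight m f u a"
    by (simp only: class_weight_def sum_divide_distrib)
  finally show ?thesis using assms by simp
qed

lemma transpose_inflate_one:
  assumes "\<And>i. i < m \<Longrightarrow> f i < n"
  shows "transpose_mat (inflate m f u (dual_weight m f u) (1\<^sub>m n)) = inflate m f u (dual_weight m f u) (1\<^sub>m n)"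
    and "transpose_mat (inflate m f (dual_weight m f u) u (1\<^sub>m n)) = inflate m f (dual_weight m f u) u (1\<^sub>m n)"
  using assms by (auto simp: inflate_def dual_weight_def)

text \<open>
  With the dual weights the inner factors cancel in every product, so that the two products of the
  matrix and its claimed inverse are inflations of the identity: they are the orthogonal projections
  $P (P^T P)^{-1} P^T$ and $Q^T (Q Q^T)^{-1} Q$.
\<close>

lemma moore_penrose_inflate:
  assumes B: "B \<in> carrier_mat n n" and C: "C \<in> carrier_mat n n" and inv: "B * C = 1\<^sub>m n" "C * B = 1\<^sub>m n"
    and f: "\<And>i. i < m \<Longrightarrow> f i < n"
    and w: "\<And>a. a < n \<Longrightarrow> class_weight m f u a \<noteq> 0" "\<And>a. a < n \<Longrightarrow> class_weight m f v a \<noteq> 0"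
  shows "moore_penrose_inverse (inflate m f u v B)
    = inflate m f (dual_weight m f v) (dual_weight m f u) C"
proof (rule moore_penrose_inverse_eqI)
  let ?A = "inflate m f u v B" and ?X = "inflate m f (dual_weight m f v) (dual_weight m f u) C"
  note unit = dual_weight_unit[OF w(1)] dual_weight_unit[OF w(2)]
  have unit': "(\<Sum>k | k < m \<and> f k = a. dual_weight m f u k * u k) = 1" if "a < n" for a
    using unit(1)[OF that] by (simp add: mult.commute)
  have AX: "?A * ?X = inflate m f u (dual_weight m f u) (1\<^sub>m n)"
    using inflate_mult[OF B C f unit(2)] by (simp add: inv)
  have XA: "?X * ?A = inflate m f (dual_weight m f v) v (1\<^sub>m n)"
    using inflate_mult[OF C B f unit'] by (simp add: inv)
  have "?A * ?X * ?A = ?A" unfolding AX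
    using inflate_mult[OF one_carrier_mat B f unit'] B by simp
  moreover have "?X * ?A * ?X = ?X" unfolding XA
    using inflate_mult[OF one_carrier_mat C f unit(2)] C by simp
  ultimately show "is_moore_penrose ?A ?X"
    unfolding is_moore_penrose_def AX XA
    using transpose_inflate_one[OF f] by (auto simp: inflate_def)
qed

section \<open>Doubling one index\<close>

lemma invertible_matE:
  fixes B :: "real mat"
  assumes B: "B \<in> carrier_mat n n" and inv: "invertible_mat B"
  obtains C where "C \<in> carrier_mat n n" "B * C = 1\<^sub>m n" "C * B = 1\<^sub>m n"
proof -
  obtain C where C: "B * C = 1\<^sub>m n" "C * B = 1\<^sub>m (dim_row C)"
    using inv B by (auto simp: invertible_mat_def inverts_mat_def)
  have "dim_col C = n" using arg_cong[OF C(1), of dim_col] by simp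
  moreover have "dim_row C = n" using arg_cong[OF C(2), of dim_col] B by simp
  ultimately show thesis using that[of C] C by auto
qed

text \<open>
  Subtracting \<open>z\<close> times row \<open>r\<close> from the last row clears that row up to its corner, so the determinant
  is, by expansion along the last row, the new corner times the determinant of the leading block.
\<close>

lemma proportional_row_of_singular:
  fixes A :: "real mat"
  assumes A: "A \<in> carrier_mat (n + 1) (n + 1)" and r: "r < n"
    and sing: "\<not> invertible_mat A" and B: "invertible_mat (mat_delete A n n)"
    and row: "\<And>j. j < n \<Longrightarrow> A $$ (n, j) = z * A $$ (r, j)"
  shows "A $$ (n, n) = z * A $$ (r, n)"
proof (rule ccontr)
  assume ne: "\<not> ?thesis"
  let ?B = "mat_delete A n n"
  define A' where "A' = addrow (- z) n r A"
  have A': "A' \<in> carrier_mat (n + 1) (n + 1)" using A by (simp add: A'_def)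
  have B': "?B \<in> carrier_mat n n" using A by (auto simp: mat_delete_def)
  obtain C where C: "C \<in> carrier_mat n n" "?B * C = 1\<^sub>m n"
    using invertible_matE[OF B' B] .
  have detB: "det ?B \<noteq> 0" using det_mult[OF B' C(1)] C(2) by auto
  have row': "A' $$ (n, j) = (if j = n then A $$ (n, n) - z * A $$ (r, n) else 0)" if "j < n + 1" for j
    using that A row[of j] by (auto simp: A'_def)
  have "det A = det A'" using det_addrow[OF _ _ A, of r n "- z"] r by (simp add: A'_def)
  also have "\<dots> = (\<Sum>j<n + 1. A' $$ (n, j) * cofactor A' n j)"
    by (rule laplace_expansion_row[OF A']) simp
  also have "\<dots> = (A $$ (n, n) - z * A $$ (r, n)) * cofactor A' n n"
    by (simp add: row')
  also have "mat_delete A' n n = ?B" using A by (auto simp: mat_delete_def A'_def)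
  then have "cofactor A' n n = det ?B" by (simp add: cofactor_def flip: power_add mult_2)
  finally have "det A \<noteq> 0" using ne detB by simp
  from det_non_zero_imp_unit[OF A this, of undefined] have "invertible_mat A"
    using A by (auto simp: Units_def ring_mat_def invertible_mat_def inverts_mat_def)
  with sing show False by simp
qed


text \<open>
  The new index \<open>n\<close> is a copy of \<open>r\<close>, scaled by \<open>z\<close> as a row and by \<open>y\<close> as a column.
\<close>

definition twin_mat :: "nat \<Rightarrow> nat \<Rightarrow> real \<Rightarrow> real \<Rightarrow> real mat \<Rightarrow> real mat" where
  "twin_mat n r z y B = inflate (n + 1) (id(n := r)) ((\<lambda>_. 1)(n := z)) ((\<lambda>_. 1)(n := y)) B"

lemma transpose_twin_mat:
  assumes "B \<in> carrier_mat n n" "r < n"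
  shows "transpose_mat (twin_mat n r z y B) = twin_mat n r y z (transpose_mat B)"
  using assms by (auto simp: twin_mat_def inflate_def)

lemma mat_delete_twin_mat:
  assumes "B \<in> carrier_mat n n"
  shows "mat_delete (twin_mat n r z y B) n n = B"
  using assms by (auto simp: twin_mat_def inflate_def mat_delete_def)

lemma has_block_form_twin_mat_iff:
  assumes B: "B \<in> carrier_mat n n" and r: "r < n" and Brr: "B $$ (r, r) \<noteq> 0"
  shows "has_block_form n r (twin_mat n r z y B) \<longleftrightarrow>
    z \<noteq> 0 \<and> y = 0 \<and> (\<exists>c. c \<noteq> 0 \<and> col B r = c \<cdot>\<^sub>v unit_vec n r)"
proof -
  define M where "M \<zeta> = four_block_mat B (0\<^sub>m n 1)
    (\<zeta> \<cdot>\<^sub>m (mat_of_row (unit_vec n r) * B)) (0\<^sub>m 1 1)" for \<zeta> :: real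
  have row: "(mat_of_row (unit_vec n r) * B) $$ (0, j) = B $$ (r, j)" if "j < n" for j
    using that B r by simp
  have M: "M \<zeta> $$ (i, j) = (if j = n then 0 else if i = n then \<zeta> * B $$ (r, j) else B $$ (i, j))"
    if "i < n + 1" "j < n + 1" for \<zeta> i j
    using that B row[of j] by (auto simp: M_def)
  have "(\<exists>\<zeta>. \<zeta> \<noteq> 0 \<and> twin_mat n r z y B = M \<zeta>) \<longleftrightarrow> z \<noteq> 0 \<and> y = 0"
  proof
    assume "\<exists>\<zeta>. \<zeta> \<noteq> 0 \<and> twin_mat n r z y B = M \<zeta>"
    then obtain \<zeta> where \<zeta>: "\<zeta> \<noteq> 0" "twin_mat n r z y B = M \<zeta>" by blast
    have "y * B $$ (r, r) = M \<zeta> $$ (r, n)"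
      unfolding \<zeta>(2)[symmetric] using r by (simp add: twin_mat_def inflate_def)
    moreover have "z * B $$ (r, r) = M \<zeta> $$ (n, r)"
      unfolding \<zeta>(2)[symmetric] using r by (simp add: twin_mat_def inflate_def)
    ultimately show "z \<noteq> 0 \<and> y = 0" using M r \<zeta>(1) Brr by simp
  next
    assume zy: "z \<noteq> 0 \<and> y = 0"
    have "twin_mat n r z y B = M z"
    proof (rule eq_matI)
      show "dim_row (twin_mat n r z y B) = dim_row (M z)" "dim_col (twin_mat n r z y B) = dim_col (M z)"
        using B by (auto simp: twin_mat_def inflate_def M_def)
      fix i j assume "i < dim_row (M z)" "j < dim_col (M z)"
      then have "i < n + 1" "j < n + 1" using B by (auto simp: M_def)
      then show "twin_mat n r z y B $$ (i, j) = M z $$ (i, j)"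
        using M zy by (auto simp: twin_mat_def inflate_def)
    qed
    with zy show "\<exists>\<zeta>. \<zeta> \<noteq> 0 \<and> twin_mat n r z y B = M \<zeta>" by blast
  qed
  then show ?thesis
    unfolding has_block_form_def mat_delete_twin_mat[OF B] Let_def M_def by blast
qed

text \<open>
  Row and column scalings trade places in the inverse, hence \<open>y\<close> governs the last row and \<open>z\<close> the last
  column.  All other scaling factors are nonzero, since each class weight is a sum of squares that
  contains a 1.
\<close>

lemma index_moore_penrose_twin_mat_eq_0_iff:
  assumes B: "B \<in> carrier_mat n n" and C: "C \<in> carrier_mat n n" and inv: "B * C = 1\<^sub>m n" "C * B = 1\<^sub>m n"
    and r: "r < n" and ij: "i < n + 1" "j < n + 1"
  shows "moore_penrose_inverse (twin_mat n r z y B) $$ (i, j) = 0 \<longleftrightarrow>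
    (i = n \<and> y = 0) \<or> C $$ ((id(n := r)) i, (id(n := r)) j) = 0 \<or> (j = n \<and> z = 0)"
proof -
  let ?f = "id(n := r)" and ?u = "(\<lambda>_. 1)(n := z)" and ?v = "(\<lambda>_. 1)(n := y)"
  have f: "?f k < n" if "k < n + 1" for k using that r by auto
  have weight: "class_weight (n + 1) ?f ((\<lambda>_. 1)(n := x)) a \<noteq> 0" if "a < n" for a and x :: real
  proof -
    have "0 < class_weight (n + 1) ?f ((\<lambda>_. 1)(n := x)) a"
      unfolding class_weight_def by (rule sum_pos2[of _ a]) (use that in auto)
    then show ?thesis by simp
  qed
  have "moore_penrose_inverse (twin_mat n r z y B) =
      inflate (n + 1) ?f (dual_weight (n + 1) ?f ?v) (dual_weight (n + 1) ?f ?u) C"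
    unfolding twin_mat_def by (rule moore_penrose_inflate[OF B C inv f weight weight])
  moreover have "dual_weight (n + 1) ?f ?v i = 0 \<longleftrightarrow> i = n \<and> y = 0"
      "dual_weight (n + 1) ?f ?u j = 0 \<longleftrightarrow> j = n \<and> z = 0"
    using weight[OF f[OF ij(1)], of y] weight[OF f[OF ij(2)], of z]
    unfolding dual_weight_def divide_eq_0_iff by simp_all
  ultimately show ?thesis using ij by (simp add: inflate_def)
qed

lemma inverse_col_multiple_of_unit_vec:
  fixes B C :: "real mat"
  assumes B: "B \<in> carrier_mat n n" and C: "C \<in> carrier_mat n n" and inv: "C * B = 1\<^sub>m n"
    and r: "r < n" and col: "c \<noteq> 0" "col B r = c \<cdot>\<^sub>v unit_vec n r"
  shows "col C r = (1 / c) \<cdot>\<^sub>v unit_vec n r"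
proof -
  have "unit_vec n r = col (C * B) r" using inv r by simp
  also have "\<dots> = C *\<^sub>v (c \<cdot>\<^sub>v unit_vec n r)" using col_mult2[OF C B r] col(2) by simp
  also have "\<dots> = c \<cdot>\<^sub>v col C r"
    using C r mult_mat_vec[OF C, of "unit_vec n r" c] col_mult2[OF C one_carrier_mat r] by simp
  finally have "(1 / c) \<cdot>\<^sub>v unit_vec n r = (1 / c) \<cdot>\<^sub>v (c \<cdot>\<^sub>v col C r)" by simp
  also have "\<dots> = col C r" using col(1) by (simp add: smult_smult_assoc)
  finally show ?thesis by simp
qed

lemma col_multiple_of_unit_vec_iff_inverse:
  fixes B C :: "real mat"
  assumes B: "B \<in> carrier_mat n n" and C: "C \<in> carrier_mat n n" and inv: "B * C = 1\<^sub>m n" "C * B = 1\<^sub>m n"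
    and r: "r < n"
  shows "(\<exists>c. c \<noteq> 0 \<and> col B r = c \<cdot>\<^sub>v unit_vec n r) \<longleftrightarrow>
    C $$ (r, r) \<noteq> 0 \<and> (\<forall>i<n. i \<noteq> r \<longrightarrow> C $$ (i, r) = 0)" (is "?L \<longleftrightarrow> ?R")
proof
  assume ?L
  then obtain c where c: "c \<noteq> 0" "col C r = (1 / c) \<cdot>\<^sub>v unit_vec n r"
    using inverse_col_multiple_of_unit_vec[OF B C inv(2) r] by blast
  have "C $$ (i, r) = (if i = r then 1 / c else 0)" if "i < n" for i
    using arg_cong[OF c(2), of "\<lambda>v. v $ i"] that r C by (simp split: if_splits)
  with c(1) r show ?R by auto
next
  assume ?R
  then have "col C r = C $$ (r, r) \<cdot>\<^sub>v unit_vec n r" "C $$ (r, r) \<noteq> 0"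
    using C r by auto
  then show ?L using inverse_col_multiple_of_unit_vec[OF C B inv(1) r] by (metis divide_eq_0_iff one_neq_zero)
qed

section \<open>The characterisation\<close>

theorem theorem2p10:
  fixes n r :: nat and G :: "nat pair_pre_digraph" and A :: "real mat"
  assumes "n \<ge> 3"
    and "tree_graph G" and "pverts G = {0..<n + 1}"
    and "pendant G n" and "(r, n) \<in> parcs G"
    and "A \<in> carrier_mat (n + 1) (n + 1)"
    and "\<not> invertible_mat A"
    and "treeangle_property G A"
    and "\<And>i j. (i, j) \<in> parcs G \<Longrightarrow> A $$ (i, j) \<noteq> 0 \<or> A $$ (j, i) \<noteq> 0"
    and "\<And>i. interior_vertex G i \<Longrightarrow> A $$ (i, i) \<noteq> 0"
    and "invertible_mat (mat_delete A n n)"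
  shows "treediagonal G (moore_penrose_inverse A) \<longleftrightarrow>
    has_block_form n r A \<or> has_block_form n r (transpose_mat A)"
proof -
  note n3 = assms(1) and tree = assms(2) and verts = assms(3) and leaf = assms(4)
    and rn = assms(5) and A = assms(6) and edges = assms(9) and diag = assms(10)
  interpret pair_graph G using tree by (simp add: tree_graph_def)
  have sym: "(j, i) \<in> parcs G" if "(i, j) \<in> parcs G" for i j using arcs_symmetric that .
  have r: "r < n" using in_arcsD1[OF rn] no_loops'[OF rn] verts by auto
  have n_edge: "(i, n) \<in> parcs G \<longleftrightarrow> i = r" for i
    using pendant_unique_neighbour[OF tree leaf] sym rn by blast
  have n_leaf: "\<not> interior_vertex G n" using leaf by (auto simp: pendant_def interior_vertex_def)
  have angle: "A $$ (i, j) * A $$ (k, k) = A $$ (i, k) * A $$ (k, j)"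
    if "on_path G i j k" "i < n + 1" "j < n + 1" "k < n + 1" for i j k
  proof -
    have "i \<in> pverts G" "j \<in> pverts G" "k \<in> pverts G" using that verts by auto
    with that(1) assms(8) show ?thesis unfolding treeangle_property_def by blast
  qed

  \<comment> \<open>The tree without its pendant vertex.  A neighbour towards another vertex stays inside it,
    since the interior vertices of a path have degree at least 2.\<close>
  define E where "E i j \<longleftrightarrow> (i, j) \<in> parcs G \<and> i < n \<and> j < n" for i j
  have "\<exists>m. E m j \<and> on_path G i j m \<and> (m = i \<or> interior_vertex G m)
      \<and> (\<forall>k. E j k \<longrightarrow> k \<noteq> m \<longrightarrow> on_path G i k j)" if ij: "i < n" "j < n" "i \<noteq> j" for i j
  proof -
    have "i \<in> pverts G" "j \<in> pverts G" using ij verts by auto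
    from tree_gate[OF tree this ij(3)] obtain m where m: "(m, j) \<in> parcs G" "on_path G i j m"
      "m = i \<or> interior_vertex G m" "\<And>k. (j, k) \<in> parcs G \<Longrightarrow> k \<noteq> m \<Longrightarrow> on_path G i k j" by blast
    have "m < n + 1" using in_arcsD1[OF m(1)] verts by simp
    moreover have "m \<noteq> n" using m(3) n_leaf ij(1) by auto
    ultimately show ?thesis using m ij(2) by (intro exI[of _ m]) (auto simp: E_def)
  qed
  then obtain g where g: "i < n \<Longrightarrow> j < n \<Longrightarrow> i \<noteq> j \<Longrightarrow> E (g i j) j \<and> on_path G i j (g i j)
      \<and> (g i j = i \<or> interior_vertex G (g i j))
      \<and> (\<forall>k. E j k \<longrightarrow> k \<noteq> g i j \<longrightarrow> on_path G i k j)" for i j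
    by metis

  define B where "B = mat_delete A n n"
  have B: "B \<in> carrier_mat n n" using A by (auto simp: B_def mat_delete_def)
  have Bij: "B $$ (i, j) = A $$ (i, j)" if "i < n" "j < n" for i j
    using that A by (simp add: B_def mat_delete_def)
  obtain C where C: "C \<in> carrier_mat n n" and inv: "B * C = 1\<^sub>m n" "C * B = 1\<^sub>m n"
    using invertible_matE[OF B] assms(11) unfolding B_def by blast

  \<comment> \<open>The neighbour \<open>s\<close> of \<open>r\<close> towards some vertex other than \<open>r\<close> and \<open>n\<close>: it makes \<open>r\<close> interior, and
    it later excludes that both scaling factors are nonzero.\<close>
  define l :: nat where "l = (if r = 0 then 1 else 0)"
  define s where "s = g l r"
  have s: "E s r" using g[of l r] r n3 by (auto simp: l_def s_def)
  have "interior_vertex G r"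
    by (rule interior_vertexI[OF tree _ rn, of s]) (use s sym in \<open>auto simp: E_def\<close>)
  then have Arr: "A $$ (r, r) \<noteq> 0" by (rule diag)

  interpret T: tree_matrix n E g B
  proof
    show "2 \<le> n" "B \<in> carrier_mat n n" using n3 B by auto
    show "i < n \<and> j < n" if "E i j" for i j using that by (simp add: E_def)
    show "\<not> E i i" for i using no_loops' by (auto simp: E_def)
    show "E j i" if "E i j" for i j using that sym by (auto simp: E_def)
    show "E (g i j) j" if "i < n" "j < n" "i \<noteq> j" for i j using g that by blast
    show "B $$ (i, j) * B $$ (g i j, g i j) = B $$ (i, g i j) * B $$ (g i j, j)"
      if "i < n" "j < n" "i \<noteq> j" for i j
      using g[OF that] that angle[of i j "g i j"] by (simp add: Bij E_def)
    show "B $$ (i, k) * B $$ (j, j) = B $$ (i, j) * B $$ (j, k)"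
      if "i < n" "i \<noteq> j" "E j k" "k \<noteq> g i j" for i j k
      using g[of i j] that angle[of i k j] by (simp add: Bij E_def)
    show "k = k'" if "E j k" "E j k'" "B $$ (j, j) = 0" for j k k'
      using interior_vertexI[OF tree, of j k k'] that diag[of j] by (auto simp: E_def Bij)
    show "B $$ (j, j) \<noteq> 0 \<or> B $$ (k, k) \<noteq> 0" if jk: "E j k" for j k
    proof -
      \<comment> \<open>A path from a third vertex meets one end of the edge first, so that end has degree at least 2.\<close>
      have "\<exists>i<3. i \<noteq> j \<and> i \<noteq> k" by presburger
      then obtain i where i: "i < n" "i \<noteq> j" "i \<noteq> k" using n3 less_le_trans by blast
      have "j < n" "k < n" using jk by (auto simp: E_def)
      note gij = g[OF i(1) this(1) i(2)]
      have "interior_vertex G j \<or> interior_vertex G k"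
      proof (cases "g i j = k")
        case True
        then show ?thesis using gij i(3) by auto
      next
        case False
        then show ?thesis
          using interior_vertexI[OF tree, of j k "g i j"] gij jk sym by (auto simp: E_def)
      qed
      then show ?thesis using diag \<open>j < n\<close> \<open>k < n\<close> by (auto simp: Bij)
    qed
  qed

  define z where "z = A $$ (n, r) / A $$ (r, r)"
  define y where "y = A $$ (r, n) / A $$ (r, r)"
  have on_r: "on_path G i n r" if i: "i < n" for i
  proof -
    have "i \<in> pverts G" "n \<in> pverts G" "i \<noteq> n" using i verts by auto
    from tree_gate[OF tree this] obtain m where "(m, n) \<in> parcs G" "on_path G i n m" by blast
    then show ?thesis using n_edge by simp
  qed
  have last_col: "A $$ (i, n) = y * A $$ (i, r)" if "i < n" for i
    using angle[OF on_r[OF that]] that r Arr by (simp add: y_def field_simps)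
  have last_row: "A $$ (n, j) = z * A $$ (r, j)" if "j < n" for j
    using angle[OF on_path_sym[OF tree on_r[OF that]]] that r Arr by (simp add: z_def field_simps)
  have corner: "A $$ (n, n) = z * A $$ (r, n)"
    by (rule proportional_row_of_singular[OF A r assms(7,11) last_row])
  have A_eq: "A = twin_mat n r z y B"
  proof (rule eq_matI)
    show "dim_row A = dim_row (twin_mat n r z y B)" "dim_col A = dim_col (twin_mat n r z y B)"
      using A by (auto simp: twin_mat_def inflate_def)
    fix i j assume "i < dim_row (twin_mat n r z y B)" "j < dim_col (twin_mat n r z y B)"
    then have "i < n + 1" "j < n + 1" by (auto simp: twin_mat_def inflate_def)
    then show "A $$ (i, j) = twin_mat n r z y B $$ (i, j)"
      using r last_col last_row corner by (auto simp: twin_mat_def inflate_def Bij less_Suc_eq)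
  qed
  have zy: "z \<noteq> 0 \<or> y \<noteq> 0" using edges[OF rn] Arr by (auto simp: z_def y_def)

  have C_off: "C $$ (i, j) = 0" if "i < n" "j < n" "i \<noteq> j" "(i, j) \<notin> parcs G" for i j
    using T.inverse_zero_off_edges[OF C inv(2)] that by (auto simp: E_def)
  have C_on: "C $$ (i, j) \<noteq> 0 \<or> C $$ (j, i) \<noteq> 0" if "i < n" "j < n" "(i, j) \<in> parcs G" for i j
    using T.inverse_zero_on_edges_iff[OF C inv(2), of i j] T.inverse_zero_on_edges_iff[OF C inv(2), of j i]
      edges[OF that(3)] that sym by (auto simp: E_def Bij)

  let ?X = "moore_penrose_inverse A"
  have X: "?X $$ (i, j) = 0 \<longleftrightarrow>
      (i = n \<and> y = 0) \<or> C $$ ((id(n := r)) i, (id(n := r)) j) = 0 \<or> (j = n \<and> z = 0)"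
    if "i < n + 1" "j < n + 1" for i j
    unfolding A_eq by (rule index_moore_penrose_twin_mat_eq_0_iff[OF B C inv r that])
  have "treediagonal G ?X \<longleftrightarrow> C $$ (r, r) \<noteq> 0 \<and>
      (\<forall>i<n. i \<noteq> r \<longrightarrow> (z = 0 \<or> C $$ (i, r) = 0) \<and> (y = 0 \<or> C $$ (r, i) = 0))" (is "_ \<longleftrightarrow> ?core")
  proof
    assume X_tree: "treediagonal G ?X"
    have "?X $$ (r, n) \<noteq> 0 \<or> ?X $$ (n, r) \<noteq> 0"
      using X_tree rn r verts unfolding treediagonal_def by auto
    then have "C $$ (r, r) \<noteq> 0" using X[of r n] X[of n r] r by auto
    moreover have "(z = 0 \<or> C $$ (i, r) = 0) \<and> (y = 0 \<or> C $$ (r, i) = 0)" if i: "i < n" "i \<noteq> r" for i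
    proof -
      have "?X $$ (i, n) = 0 \<and> ?X $$ (n, i) = 0"
        using X_tree i n_edge[of i] verts unfolding treediagonal_def by auto
      then show ?thesis using X[of i n] X[of n i] i by auto
    qed
    ultimately show ?core by blast
  next
    assume core: ?core
    have off: "?X $$ (i, j) = 0" if ij: "i < n + 1" "j < n + 1" "i \<noteq> j" "(i, j) \<notin> parcs G" for i j
    proof -
      have "i < n \<or> i = n" "j < n \<or> j = n" using ij by auto
      moreover have "i = n \<Longrightarrow> j \<noteq> r" "j = n \<Longrightarrow> i \<noteq> r" using ij(4) rn sym[OF rn] by auto
      ultimately consider "i < n" "j < n" | "i = n" "j < n" "j \<noteq> r" | "j = n" "i < n" "i \<noteq> r"
        using ij(3) by blast
      then show ?thesis using X[OF ij(1,2)] C_off[of i j] core ij by cases auto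
    qed
    have on: "?X $$ (i, j) \<noteq> 0 \<or> ?X $$ (j, i) \<noteq> 0"
      if ij: "i < n + 1" "j < n + 1" "(i, j) \<in> parcs G" for i j
    proof -
      have "i < n \<or> i = n" "j < n \<or> j = n" using ij by auto
      then consider "i < n" "j < n" | "i = n" "j = r" | "j = n" "i = r"
        using ij(3) n_edge sym[OF ij(3)] by blast
      then show ?thesis using X[OF ij(1,2)] X[OF ij(2,1)] C_on[of i j] core ij zy r by cases auto
    qed
    show "treediagonal G ?X"
      unfolding treediagonal_def
    proof (intro ballI conjI impI; (elim conjE)?)
      fix i j assume "i \<in> pverts G" "j \<in> pverts G"
      then have ij: "i < n + 1" "j < n + 1" using verts by auto
      show "?X $$ (i, j) \<noteq> 0 \<or> ?X $$ (j, i) \<noteq> 0" if "(i, j) \<in> parcs G"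
        using on[OF ij that] .
      assume ne: "i \<noteq> j" "(i, j) \<notin> parcs G"
      then show "?X $$ (i, j) = 0" by (rule off[OF ij])
      have "(j, i) \<notin> parcs G" using ne(2) sym by blast
      with ne(1) show "?X $$ (j, i) = 0" using off[OF ij(2,1)] by blast
    qed
  qed
  also have "\<dots> \<longleftrightarrow>
      (z \<noteq> 0 \<and> y = 0 \<and> C $$ (r, r) \<noteq> 0 \<and> (\<forall>i<n. i \<noteq> r \<longrightarrow> C $$ (i, r) = 0)) \<or>
      (y \<noteq> 0 \<and> z = 0 \<and> C $$ (r, r) \<noteq> 0 \<and> (\<forall>i<n. i \<noteq> r \<longrightarrow> C $$ (r, i) = 0))"
  proof -
    have "s < n" "s \<noteq> r" "C $$ (s, r) \<noteq> 0 \<or> C $$ (r, s) \<noteq> 0"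
      using s C_on[of s r] no_loops' by (auto simp: E_def)
    then show ?thesis using zy by blast
  qed
  also have "\<dots> \<longleftrightarrow> has_block_form n r A \<or> has_block_form n r (transpose_mat A)"
  proof -
    have Brr: "B $$ (r, r) \<noteq> 0" using Arr r by (simp add: Bij)
    have Bt: "transpose_mat B \<in> carrier_mat n n" and Ct: "transpose_mat C \<in> carrier_mat n n"
      using B C by auto
    have invt: "transpose_mat B * transpose_mat C = 1\<^sub>m n"
        "transpose_mat C * transpose_mat B = 1\<^sub>m n"
      using inv transpose_mult[OF C B, symmetric] transpose_mult[OF B C, symmetric] by simp_all
    have "has_block_form n r A \<longleftrightarrow>
        z \<noteq> 0 \<and> y = 0 \<and> C $$ (r, r) \<noteq> 0 \<and> (\<forall>i<n. i \<noteq> r \<longrightarrow> C $$ (i, r) = 0)"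
      unfolding A_eq has_block_form_twin_mat_iff[where z = z and y = y, OF B r Brr]
        col_multiple_of_unit_vec_iff_inverse[OF B C inv r] ..
    moreover have "has_block_form n r (transpose_mat A) \<longleftrightarrow>
        y \<noteq> 0 \<and> z = 0 \<and> C $$ (r, r) \<noteq> 0 \<and> (\<forall>i<n. i \<noteq> r \<longrightarrow> C $$ (r, i) = 0)"
      unfolding A_eq transpose_twin_mat[OF B r]
      using has_block_form_twin_mat_iff[where z = y and y = z, OF Bt r]
        col_multiple_of_unit_vec_iff_inverse[OF Bt Ct invt r] Brr B C r by auto
    ultimately show ?thesis by blast
  qed
  finally show ?thesis .
qed

end
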